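(* Let $a$ be a positive integer and let $b\ge 1$ be an integer. (i) If $a\equiv 2$ or $18\pmod{20}$, then $\#S(a,1)=0$ and $\#S(a,b)=(b-2)\cdot V(a)=(b-2)\cdot v_5(a^2+1)$ for every $b\ge 2$. (ii) If $a\equiv 8$ or $12\pmod{20}$, then $\#S(a,b)=(b-1)\cdot V(a)=(b-1)\cdot v_5(a^2+1)$ for every $b\ge 1$.
   Context: $v_5$ denotes the $5$-adic valuation on $\mathbb{Z}$. For an integer $a\ge 1$, the tetration ${}^{b}a$ is defined by ${}^{1}a=a$ and ${}^{b}a=a^{({}^{b-1}a)}$ for $b\ge 2$. For an integer $a\ge 2$ not divisible by $10$ and $b\ge 1$, the number of stable digits $\#S(a,b)$ is the non-negative integer $n$ such that ${}^{b}a\equiv {}^{b+1}a \pmod{10^{n}}$ and ${}^{b}a\not\equiv {}^{b+1}a\pmod{10^{n+1}}$. The congruence speed of $a$ at height $b$ is $V(a,b):=\#S(a,b)-\#S(a,b-1)$ for $b\ge 2$ and $V(a,1):=\#S(a,1)$, so that $\#S(a,b)=\sum_{i=1}^{b}V(a,i)$. It is known that $V(a,b)$ is constant for all sufficiently large $b$ (for instance for $b\ge a+1$); this eventual constant value is the constant congruence speed $V(a)$. *)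

theory Defs
  imports "HOL-Number_Theory.Cong" "HOL-Computational_Algebra.Primes"
begin

text \<open>
  The paper's tetration starts at height 1; with the value 1 at height 0 the recursion
  gives \<open>tetration a 1 = a\<close>, and only heights \<open>b \<ge> 1\<close> are used.
\<close>

primrec tetration :: "nat \<Rightarrow> nat \<Rightarrow> nat" where
  "tetration a 0 = 1"
| "tetration a (Suc b) = a ^ tetration a b"

lemma tetration_1: "tetration a 1 = a"
  by simp

lemma tetration_rec: "b \<ge> 2 \<Longrightarrow> tetration a b = a ^ tetration a (b - 1)"
  by (cases b) simp_all

text \<open>
  The number \<open>#S(a,b)\<close>. It is meaningful for \<open>a \<ge> 2\<close> not divisible by 10 and \<open>b \<ge> 1\<close>:
  \<open>n\<close> is unique since congruence modulo \<open>10^n\<close> is inherited by smaller exponents, and it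
  exists since the two towers then are distinct.
\<close>

definition stable_digits :: "nat \<Rightarrow> nat \<Rightarrow> nat" where
  "stable_digits a b =
     (THE n. [tetration a b = tetration a (b + 1)] (mod 10 ^ n) \<and>
             \<not> [tetration a b = tetration a (b + 1)] (mod 10 ^ (n + 1)))"

text \<open>
  The difference \<open>V(a,b)\<close> is taken in the integers, so that no truncated subtraction occurs.
  The value at \<open>b = 0\<close> is irrelevant.
\<close>

definition congruence_speed :: "nat \<Rightarrow> nat \<Rightarrow> int" where
  "congruence_speed a b =
     (if b = 1 then int (stable_digits a 1)
      else int (stable_digits a b) - int (stable_digits a (b - 1)))"

definition constant_congruence_speed :: "nat \<Rightarrow> int" where
  "constant_congruence_speed a = (THE v. \<exists>B. \<forall>b\<ge>B. congruence_speed a b = v)"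

end

(* For a = 2, 3 (mod 5) the order of a modulo 5 is 4, and a^2 - 1 is prime to 5, so lifting the
   exponent gives v_5 (a^n - 1) = v_5 (a^2 + 1) + v_5 n if 4 divides n, and 0 otherwise.
   Let d_b be the difference of the towers of heights b + 1 and b. As d_(b+1) is a power of a times
   a^(d_b) - 1, the valuation v_5 (d_b) stays 0 until 4 divides d_b, and from then on it grows by
   v_5 (a^2 + 1) at each step. For even a the 2-adic valuation of d_b is at least the height b - 1
   tower, hence at least v_5 (d_b), which is therefore the number of stable digits. *)
theory Submission imports Defs begin

section \<open>Lifting the exponent for an odd prime\<close>

lemma multiplicity_power_minus_1_coprime:
  fixes p x :: int
  assumes "prime p" "p dvd x - 1" "\<not> p dvd int k"
  shows "multiplicity p (x ^ k - 1) = multiplicity p (x - 1)"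
proof (cases "x = 1")
  case False
  have "[x = 1] (mod p)"
    using assms(2) by (simp add: cong_iff_dvd_diff)
  \<comment> \<open>The cofactor of \<open>x - 1\<close> in \<open>x ^ k - 1\<close> is congruent to
    \<open>k\<close>, hence prime to \<open>p\<close>.\<close>
  then have "[(\<Sum>i<k. x ^ i) = (\<Sum>i<k. 1 ^ i)] (mod p)"
    by (intro cong_sum cong_pow)
  then have ndvd: "\<not> p dvd (\<Sum>i<k. x ^ i)"
    using assms(3) by (simp add: cong_dvd_iff)
  then have "(\<Sum>i<k. x ^ i) \<noteq> 0"
    by auto
  then show ?thesis
    using ndvd False prime_imp_prime_elem[OF assms(1)]
    by (simp add: power_diff_1_eq prime_elem_multiplicity_mult_distrib not_dvd_imp_multiplicity_0)
qed simp

text \<open>The cofactor \<open>S\<close> of \<open>x - 1\<close> in \<open>x ^ p - 1\<close> is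
  congruent to \<open>p\<close> modulo the square of \<open>p\<close>, so it contributes exactly one
  factor \<open>p\<close>.\<close>

lemma multiplicity_power_prime_minus_1:
  fixes p :: nat and x :: int
  assumes "prime p" "odd p" "int p dvd x - 1" "x \<noteq> 1"
  shows "multiplicity (int p) (x ^ p - 1) = Suc (multiplicity (int p) (x - 1))"
proof -
  define S where "S = (\<Sum>i<p. x ^ i)"
  obtain y where y: "x = 1 + int p * y"
    using assms(3) by (metis add_diff_cancel_left' dvdE diff_add_cancel add.commute)
  \<comment> \<open>Binomial expansion of \<open>(1 + p * y) ^ i\<close>: modulo the square of
    \<open>p\<close> only the constant and linear terms survive.\<close>
  have pow: "[x ^ i = 1 + int i * (int p * y)] (mod int p ^ 2)" for i
  proof (induction i)
    case (Suc i)
    have "[x ^ Suc i = x * (1 + int i * (int p * y))] (mod int p ^ 2)"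
      using cong_mult[OF cong_refl Suc, of x] by simp
    moreover have "x * (1 + int i * (int p * y))
        = 1 + int (Suc i) * (int p * y) + int p ^ 2 * (int i * y ^ 2)"
      by (simp add: y algebra_simps power2_eq_square)
    ultimately show ?case
      by (simp add: cong_def)
  qed simp
  have "[S = (\<Sum>i<p. 1 + int i * (int p * y))] (mod int p ^ 2)"
    unfolding S_def by (intro cong_sum pow)
  moreover have "(\<Sum>i<p. 1 + int i * (int p * y)) = int p + int (\<Sum>i<p. i) * (int p * y)"
    by (simp add: sum.distrib sum_distrib_right)
  \<comment> \<open>With the factor \<open>int p * y\<close> this makes the sum of the linear terms
    vanish modulo \<open>int p ^ 2\<close>. Oddness of \<open>p\<close> allows the 2 to be cancelled
    against \<open>p * (p - 1)\<close>.\<close>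
  moreover have "p dvd (\<Sum>i<p. i)"
  proof -
    have "2 * (\<Sum>i<p. i) = p * (p - 1)"
      using assms(2) by (induction p) (auto simp: algebra_simps gauss_sum lessThan_Suc_atMost
        atMost_atLeast0 Sum_Ico_nat simp flip: atLeast0LessThan)
    then have "p dvd 2 * (\<Sum>i<p. i)"
      by simp
    then show ?thesis
      using assms(2) by (simp add: coprime_dvd_mult_right_iff)
  qed
  then have "int p ^ 2 dvd int (\<Sum>i<p. i) * (int p * y)"
    by (auto simp: power2_eq_square simp del: of_nat_sum elim!: dvdE)
  ultimately have cong: "[S = int p] (mod int p ^ 2)"
    by (simp add: cong_iff_dvd_diff) (metis diff_diff_eq2 diff_add_eq dvd_add_left_iff
        add.commute diff_add_cancel diff_diff_add)
  have "int p dvd S"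
    using cong_dvd_iff[OF cong_dvd_modulus[OF cong]] by auto
  moreover have "\<not> int p ^ 2 dvd S"
    using cong_dvd_iff[OF cong_sym[OF cong]] cong assms(1)
    by (auto simp: cong_dvd_iff[OF cong] power2_eq_square prime_nat_iff)
  ultimately have "multiplicity (int p) S = 1" "S \<noteq> 0"
    by (auto intro!: multiplicity_eqI simp: power2_eq_square)
  then show ?thesis
    using assms by (simp add: power_diff_1_eq prime_elem_multiplicity_mult_distrib flip: S_def)
qed

text \<open>Factors \<open>p\<close> are split off \<open>k\<close> one at a time: for
  \<open>k = p * m\<close> the previous lemma applies to \<open>x ^ m\<close>, and once
  \<open>p\<close> no longer divides the exponent nothing is gained.\<close>

lemma multiplicity_power_minus_1:
  fixes p :: nat and x :: int
  assumes "prime p" "odd p" "int p dvd x - 1" "x \<noteq> 1" "k > 0"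
  shows "multiplicity (int p) (x ^ k - 1)
           = multiplicity (int p) (x - 1) + multiplicity (int p) (int k)"
  using assms(5)
proof (induction k rule: less_induct)
  case (less k)
  show ?case
  proof (cases "p dvd k")
    case False
    then show ?thesis
      using assms by (simp add: multiplicity_power_minus_1_coprime not_dvd_imp_multiplicity_0)
  next
    case True
    then obtain m where m: "k = p * m"
      by blast
    have "m > 0" "m < k"
      using m less.prems prime_gt_1_nat[OF assms(1)] by auto
    then have IH: "multiplicity (int p) (x ^ m - 1)
        = multiplicity (int p) (x - 1) + multiplicity (int p) (int m)"
      by (rule less.IH[rotated])
    have "multiplicity (int p) (x - 1) > 0"
      using assms by (simp add: prime_multiplicity_gt_zero_iff)
    \<comment> \<open>The valuation of 0 is 0 by convention, so a positive valuation excludes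
      \<open>x ^ m - 1 = 0\<close>.\<close>
    with IH have "x ^ m \<noteq> 1"
      by (intro notI) simp
    moreover have "int p dvd x ^ m - 1"
      using assms(3) by (simp add: power_diff_1_eq)
    ultimately have "multiplicity (int p) ((x ^ m) ^ p - 1)
        = Suc (multiplicity (int p) (x ^ m - 1))"
      using assms(1,2) by (intro multiplicity_power_prime_minus_1)
    moreover have "(x ^ m) ^ p = x ^ k"
      by (simp add: m mult.commute flip: power_mult)
    moreover have "multiplicity (int p) (int k) = Suc (multiplicity (int p) (int m))"
      using \<open>m > 0\<close> assms(1)
      by (simp add: m prime_elem_multiplicity_mult_distrib prime_gt_0_nat)
    ultimately show ?thesis
      using IH by simp
  qed
qed

section \<open>Powers of 2 and 3 modulo 5\<close>

lemma pow4_cong_1_mod_5: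
  fixes a :: int
  assumes "a mod 5 = 2 \<or> a mod 5 = 3"
  shows "[a ^ 4 = 1] (mod 5)"
proof -
  have "a ^ 4 mod 5 = (a mod 5) ^ 4 mod 5"
    by (simp add: power_mod)
  then show ?thesis
    using assms by (auto simp: cong_def)
qed

lemma five_not_dvd_power_minus_1:
  fixes a :: int
  assumes "a mod 5 = 2 \<or> a mod 5 = 3" "\<not> 4 dvd n"
  shows "\<not> 5 dvd a ^ n - 1"
proof
  assume "5 dvd a ^ n - 1"
  then have "[a ^ n = 1] (mod 5)"
    by (simp add: cong_iff_dvd_diff)
  moreover have "a ^ n = (a ^ 4) ^ (n div 4) * a ^ (n mod 4)"
    by (simp flip: power_mult power_add)
  moreover have "[(a ^ 4) ^ (n div 4) * a ^ (n mod 4) = 1 ^ (n div 4) * a ^ (n mod 4)] (mod 5)"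
    by (intro cong_mult cong_pow cong_refl pow4_cong_1_mod_5 assms)
  ultimately have "[a ^ (n mod 4) = 1] (mod 5)"
    by (simp add: cong_def)
  then have "(a mod 5) ^ (n mod 4) mod 5 = 1"
    by (simp add: cong_def power_mod)
  moreover have "n mod 4 = 1 \<or> n mod 4 = 2 \<or> n mod 4 = 3"
    using assms(2) by presburger
  ultimately show False
    using assms(1) by auto
qed

text \<open>Lifting the exponent applies to \<open>a ^ 4\<close>, which is 1 modulo 5. In
  \<open>a ^ 4 - 1\<close> only the factor \<open>a\<^sup>2 + 1\<close> can contain 5, and dividing
  \<open>n\<close> by 4 does not change its 5-adic valuation.\<close>

lemma multiplicity_5_power_minus_1:
  fixes a :: int
  assumes "a mod 5 = 2 \<or> a mod 5 = 3" "4 dvd n" "n > 0"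
  shows "multiplicity 5 (a ^ n - 1) = multiplicity 5 (a\<^sup>2 + 1) + multiplicity 5 (int n)"
proof -
  obtain m where m: "n = 4 * m"
    using assms(2) by blast
  have sq: "\<not> 5 dvd a\<^sup>2 - 1"
    using five_not_dvd_power_minus_1[OF assms(1), of 2] by simp
  have "a\<^sup>2 + 1 \<noteq> 0"
    by (smt (verit) zero_le_power2)
  have fact: "a ^ 4 - 1 = (a\<^sup>2 - 1) * (a\<^sup>2 + 1)"
    by (simp add: algebra_simps flip: power_add)
  then have "a ^ 4 \<noteq> 1"
    using sq \<open>a\<^sup>2 + 1 \<noteq> 0\<close> by (intro notI) auto
  have "multiplicity 5 (a ^ n - 1) = multiplicity (int 5) ((a ^ 4) ^ m - 1)"
    by (simp add: m power_mult)
  also have "\<dots> = multiplicity (int 5) (a ^ 4 - 1) + multiplicity (int 5) (int m)"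
    using pow4_cong_1_mod_5[OF assms(1)] \<open>a ^ 4 \<noteq> 1\<close> assms(3) m
    by (intro multiplicity_power_minus_1) (auto simp: cong_iff_dvd_diff)
  also have "multiplicity (int 5) (a ^ 4 - 1) = multiplicity 5 (a\<^sup>2 + 1)"
    unfolding fact using sq \<open>a\<^sup>2 + 1 \<noteq> 0\<close>
    by (subst prime_elem_multiplicity_mult_distrib) (auto simp: not_dvd_imp_multiplicity_0)
  also have "multiplicity (int 5) (int m) = multiplicity 5 (int n)"
  proof -
    have "\<not> (5::int) dvd 4"
      by simp
    then show ?thesis
      using assms(3) m
      by (simp add: prime_elem_multiplicity_mult_distrib not_dvd_imp_multiplicity_0)
  qed
  finally show ?thesis .
qed

section \<open>Growth of towers and divisibility by powers of 2\<close>

lemma tetration_less_Suc: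
  assumes "a \<ge> 2"
  shows "tetration a b < tetration a (Suc b)"
  using assms by (induction b) auto

text \<open>A linear bound is enough, because the 5-adic valuation to be dominated grows only
  linearly in the height, with slope at most \<open>a\<close>.\<close>

lemma tetration_ge_mult:
  assumes "a \<ge> 2" "b \<ge> 1"
  shows "b * a \<le> tetration a b"
  using assms(2)
proof (induction b rule: dec_induct)
  case (step b)
  define t where "t = tetration a b"
  have t: "b * a \<le> t" "a \<le> t"
    using step by (auto simp: t_def intro: order.trans[rotated])
  then obtain s where s: "t = Suc s"
    using assms(1) by (cases t) auto
  have "t \<le> 2 ^ s"
    using less_exp[of s] by (simp only: s Suc_le_eq)
  also have "\<dots> \<le> a ^ s"
    using assms(1) by (intro power_mono) auto
  finally have "a * t \<le> a ^ t"
    using mult_le_mono2[of t "a ^ s" a] by (simp add: s)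
  moreover have "a + t \<le> a * t"
  proof -
    \<comment> \<open>Expanding \<open>(a - 1) * (t - 1) \<ge> 1\<close> gives the claim.\<close>
    have "1 * 1 \<le> (a - 1) * (t - 1)"
      using assms(1) t by (intro mult_mono) auto
    then show ?thesis
      using assms(1) t by (auto simp: algebra_simps s)
  qed
  ultimately show ?case
    using t by (simp add: t_def)
qed simp

text \<open>For \<open>a \<ge> 2\<close> the towers increase strictly, so the subtraction is not
  truncated. Height 0 is included because \<open>a - 1\<close> starts the recursion.\<close>

definition tetration_diff :: "nat \<Rightarrow> nat \<Rightarrow> nat" where
  "tetration_diff a b = tetration a (Suc b) - tetration a b"

lemma tetration_diff_pos: "a \<ge> 2 \<Longrightarrow> tetration_diff a b > 0"
  using tetration_less_Suc by (simp add: tetration_diff_def del: tetration.simps)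

lemma tetration_diff_Suc:
  assumes "a \<ge> 2"
  shows "int (tetration_diff a (Suc b))
           = int a ^ tetration a b * (int a ^ tetration_diff a b - 1)"
proof -
  have "tetration a (Suc b) = tetration a b + tetration_diff a b"
    using tetration_less_Suc[OF assms, of b] by (simp add: tetration_diff_def del: tetration.simps)
  then have "tetration a (Suc (Suc b)) = a ^ tetration a b * a ^ tetration_diff a b"
    by (metis tetration.simps(2) power_add)
  then show ?thesis
    using assms by (simp add: tetration_diff_def of_nat_diff algebra_simps)
qed

lemma power_2_dvd_tetration:
  assumes "even a" "k \<le> tetration a b"
  shows "2 ^ k dvd tetration a (Suc b)"
  using dvd_power_same[OF assms(1)] le_imp_power_dvd[OF assms(2), of a]
  by (auto intro: dvd_trans)

lemma power_2_dvd_tetration_diff: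
  assumes "a \<ge> 2" "even a" "k \<le> tetration a b"
  shows "2 ^ k dvd tetration_diff a (Suc b)"
  unfolding tetration_diff_def
  using assms tetration_less_Suc[OF assms(1), of b]
  by (intro dvd_diff_nat power_2_dvd_tetration) (auto simp del: tetration.simps)

text \<open>If 4 divides \<open>a\<close>, any positive exponent will do. Otherwise the exponent is
  a tower of height at least 1, hence at least 2, and the square of an even number is divisible by
  4.\<close>

lemma four_dvd_tetration:
  assumes "a \<ge> 2" "even a" "b \<ge> 1" "4 dvd a \<or> b \<ge> 2"
  shows "4 dvd tetration a b"
proof -
  obtain c where c: "b = Suc c"
    using assms(3) by (cases b) auto
  show ?thesis
  proof (cases "4 dvd a")
    case True
    have "tetration a c > 0"
      using assms(1) by (cases c) auto
    then show ?thesis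
      using True by (auto simp: c intro: dvd_trans dvd_power)
  next
    case False
    then have "c \<ge> 1"
      using assms(4) c by auto
    then have "1 * 2 \<le> c * a"
      using assms(1) by (intro mult_mono) auto
    also have "c * a \<le> tetration a c"
      using assms(1) \<open>c \<ge> 1\<close> by (rule tetration_ge_mult)
    finally have "2 ^ 2 dvd tetration a (Suc c)"
      using assms(2) by (intro power_2_dvd_tetration) auto
    then show ?thesis
      by (simp add: c)
  qed
qed

lemma four_dvd_tetration_diff:
  assumes "a \<ge> 2" "even a" "b \<ge> 1" "4 dvd a \<or> b \<ge> 2"
  shows "4 dvd tetration_diff a b"
  unfolding tetration_diff_def using assms by (intro dvd_diff_nat four_dvd_tetration) auto

section \<open>Stable digits as a 5-adic valuation\<close>

lemma multiplicity_5_tetration_diff_Suc: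
  assumes "a \<ge> 2" "int a mod 5 = 2 \<or> int a mod 5 = 3"
  shows "multiplicity 5 (int (tetration_diff a (Suc b))) =
    (if 4 dvd tetration_diff a b
     then multiplicity 5 ((int a)\<^sup>2 + 1) + multiplicity 5 (int (tetration_diff a b)) else 0)"
proof -
  let ?d = "tetration_diff a b"
  have "\<not> 5 dvd int a"
    using assms(2) by auto
  then have "\<not> 5 dvd int a ^ tetration a b"
    using prime_dvd_power[of "5::int" "int a"] by auto
  moreover have "int a ^ ?d > 1"
    using assms(1) tetration_diff_pos[OF assms(1), of b] by (intro one_less_power) auto
  ultimately have
    "multiplicity 5 (int (tetration_diff a (Suc b))) = multiplicity 5 (int a ^ ?d - 1)"
    using assms(1)
    by (subst tetration_diff_Suc[OF assms(1)], subst prime_elem_multiplicity_mult_distrib)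
       (auto simp: not_dvd_imp_multiplicity_0)
  then show ?thesis
    using multiplicity_5_power_minus_1[OF assms(2), of ?d] tetration_diff_pos[OF assms(1), of b]
      not_dvd_imp_multiplicity_0[OF five_not_dvd_power_minus_1[OF assms(2), of ?d]]
    by auto
qed

text \<open>The second hypothesis says that 2 is never the bottleneck: \<open>10 ^ k\<close> divides
  the difference exactly when \<open>5 ^ k\<close> does, which pins down the \<open>n\<close> of the
  definition.\<close>

lemma stable_digits_eq_multiplicity_5:
  assumes "a \<ge> 2" "2 ^ multiplicity 5 (int (tetration_diff a b)) dvd tetration_diff a b"
  shows "stable_digits a b = multiplicity 5 (int (tetration_diff a b))"
proof -
  let ?d = "tetration_diff a b"
  define n where "n = multiplicity 5 (int ?d)"
  have cong_iff: "[tetration a b = tetration a (b + 1)] (mod 10 ^ k) \<longleftrightarrow> 10 ^ k dvd ?d" for k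
    using tetration_less_Suc[OF assms(1), of b]
    by (subst cong_sym_eq) (simp add: cong_altdef_nat tetration_diff_def del: tetration.simps)
  have five: "5 ^ k dvd ?d \<longleftrightarrow> k \<le> n" for k
  proof -
    have "5 ^ k dvd ?d \<longleftrightarrow> 5 ^ k dvd int ?d"
      by (metis int_dvd_int_iff of_nat_numeral of_nat_power)
    then show ?thesis
      using tetration_diff_pos[OF assms(1), of b]
      by (simp add: n_def power_dvd_iff_le_multiplicity)
  qed
  have ten: "10 ^ k dvd ?d \<longleftrightarrow> k \<le> n" for k
  proof
    assume "10 ^ k dvd ?d"
    moreover have "(5::nat) ^ k dvd 10 ^ k"
      by (rule dvd_power_same) simp
    ultimately show "k \<le> n"
      using five dvd_trans by blast
  next
    assume "k \<le> n"
    then have "2 ^ k dvd ?d" "5 ^ k dvd ?d"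
      using assms(2) five by (auto simp: n_def intro: dvd_trans le_imp_power_dvd)
    moreover have "coprime ((2::nat) ^ k) (5 ^ k)"
      by simp
    ultimately have "2 ^ k * 5 ^ k dvd ?d"
      by (simp add: divides_mult)
    then show "10 ^ k dvd ?d"
      by (simp flip: power_mult_distrib)
  qed
  show ?thesis
    unfolding stable_digits_def cong_iff ten n_def[symmetric] by (rule the_equality) auto
qed

text \<open>A valuation above \<open>a\<close> would give
  \<open>5 ^ a \<le> a\<^sup>2 + 1 \<le> (a + 1)\<^sup>2 \<le> 4 ^ a\<close>, so
  \<open>a = 0\<close>, where the valuation is 0 as well.\<close>

lemma multiplicity_5_square_plus_1_le: "multiplicity 5 ((int a)\<^sup>2 + 1) \<le> a"
proof (rule ccontr)
  let ?v = "multiplicity 5 ((int a)\<^sup>2 + 1)"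
  assume "\<not> ?v \<le> a"
  then have "(5::int) ^ a \<le> 5 ^ ?v"
    by (intro power_increasing) auto
  also have pos: "0 < (int a)\<^sup>2 + 1"
    by (smt (verit) zero_le_power2)
  then have "5 ^ ?v \<le> (int a)\<^sup>2 + 1"
    by (intro zdvd_imp_le multiplicity_dvd)
  also have "(int a)\<^sup>2 + 1 \<le> (int a + 1)\<^sup>2"
    by (simp add: power2_eq_square algebra_simps)
  also have "\<dots> \<le> (2 ^ a)\<^sup>2"
  proof (rule power_mono)
    have "int (Suc a) \<le> int (2 ^ a)"
      using less_exp[of a] by (simp only: of_nat_le_iff Suc_le_eq)
    then show "int a + 1 \<le> 2 ^ a"
      by simp
  qed simp
  also have "\<dots> = 4 ^ a"
    by (simp add: power2_eq_square flip: power_mult_distrib)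
  finally have "(5::int) ^ a \<le> 4 ^ a" .
  then have "a = 0"
    by (metis not_gr_zero not_less power_strict_mono numeral_le_iff numeral_less_iff
        semiring_norm(68,75,76,78,79,80) zero_le_numeral)
  then show False
    using \<open>\<not> ?v \<le> a\<close> by simp
qed

text \<open>Here 4 divides the differences from height \<open>s\<close> on, but not the one at
  \<open>s - 1\<close>. So the 5-adic valuation is 0 at height \<open>s\<close> and each later step
  adds \<open>?v\<close>.\<close>

lemma stable_digits_linear:
  assumes "a \<ge> 2" "even a" "int a mod 5 = 2 \<or> int a mod 5 = 3"
    and "s \<ge> 1" "\<not> 4 dvd tetration_diff a (s - 1)" "4 dvd a \<or> s \<ge> 2" "b \<ge> s"
  shows "stable_digits a b = (b - s) * multiplicity 5 ((int a)\<^sup>2 + 1)"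
proof -
  let ?v = "multiplicity 5 ((int a)\<^sup>2 + 1)"
  have mult: "multiplicity 5 (int (tetration_diff a b)) = (b - s) * ?v"
    using \<open>b \<ge> s\<close>
  proof (induction b rule: dec_induct)
    case base
    then show ?case
      using multiplicity_5_tetration_diff_Suc[OF assms(1,3), of "s - 1"] assms(4,5) by simp
  next
    case (step b)
    then have "4 dvd tetration_diff a b"
      using assms by (intro four_dvd_tetration_diff) auto
    then show ?case
      using step multiplicity_5_tetration_diff_Suc[OF assms(1,3), of b] by (simp add: Suc_diff_le)
  qed
  obtain c where c: "b = Suc c"
    using assms(4,7) by (cases b) auto
  \<comment> \<open>The required power of 2 is bounded by the tower of height \<open>b - 1\<close>;
    \<open>s \<ge> 1\<close> gives \<open>b - s \<le> c\<close>.\<close>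
  have "(b - s) * ?v \<le> c * a"
    using assms(4) c by (intro mult_mono multiplicity_5_square_plus_1_le) auto
  also have "c * a \<le> tetration a c"
    using tetration_ge_mult[OF assms(1), of c] by (cases "c = 0") auto
  finally have "2 ^ ((b - s) * ?v) dvd tetration_diff a b"
    unfolding c using assms(1,2) by (intro power_2_dvd_tetration_diff)
  then show ?thesis
    using stable_digits_eq_multiplicity_5[OF assms(1), of b] mult by simp
qed

section \<open>The constant congruence speed\<close>

lemma constant_congruence_speed_eqI:
  assumes "\<And>b. b \<ge> s \<Longrightarrow> stable_digits a b = (b - s) * v"
  shows "constant_congruence_speed a = int v"
proof -
  \<comment> \<open>From \<open>s + 2\<close> on, both heights in the difference are at least
    \<open>s\<close>, and the special branch at height 1 is avoided even for
    \<open>s = 0\<close>.\<close>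
  have speed: "congruence_speed a b = int v" if "b \<ge> s + 2" for b
  proof -
    obtain k where "b = s + 2 + k"
      using \<open>b \<ge> s + 2\<close> le_Suc_ex by blast
    then show ?thesis
      by (simp add: congruence_speed_def assms algebra_simps)
  qed
  show ?thesis
    unfolding constant_congruence_speed_def
  proof (rule the_equality)
    show "\<exists>B. \<forall>b\<ge>B. congruence_speed a b = int v"
      using speed by blast
  next
    fix w
    assume "\<exists>B. \<forall>b\<ge>B. congruence_speed a b = w"
    then obtain B where "\<forall>b\<ge>B. congruence_speed a b = w" ..
    then show "w = int v"
      using speed[of "max B (s + 2)"] by simp
  qed
qed

section \<open>The residue classes modulo 20\<close>

lemma residues_of_mod_20:
  fixes a :: nat
  assumes "a mod 20 = r"
  shows "even a \<longleftrightarrow> even r" "4 dvd a \<longleftrightarrow> 4 dvd r" "int a mod 5 = int (r mod 5)"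
proof -
  show "even a \<longleftrightarrow> even r" "4 dvd a \<longleftrightarrow> 4 dvd r"
    using dvd_mod_iff[of 2 20 a] dvd_mod_iff[of 4 20 a] assms by simp_all
  have "r mod 5 = a mod 5"
    unfolding assms[symmetric] by (rule mod_mod_cancel) simp
  then show "int a mod 5 = int (r mod 5)"
    by (simp add: zmod_int)
qed

theorem mainTheorem7:
  fixes a :: nat
  assumes "a \<ge> 1"
  shows
    "([a = 2] (mod 20) \<or> [a = 18] (mod 20) \<longrightarrow>
        stable_digits a 1 = 0 \<and>
        (\<forall>b::nat. b \<ge> 2 \<longrightarrow>
           int (stable_digits a b) = (int b - 2) * constant_congruence_speed a \<and>
           (int b - 2) * constant_congruence_speed a
             = (int b - 2) * int (multiplicity (5::int) ((int a)\<^sup>2 + 1)))) \<and>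
     ([a = 8] (mod 20) \<or> [a = 12] (mod 20) \<longrightarrow>
        (\<forall>b::nat. b \<ge> 1 \<longrightarrow>
           int (stable_digits a b) = (int b - 1) * constant_congruence_speed a \<and>
           (int b - 1) * constant_congruence_speed a
             = (int b - 1) * int (multiplicity (5::int) ((int a)\<^sup>2 + 1))))"
proof -
  let ?v = "multiplicity 5 ((int a)\<^sup>2 + 1)"
  \<comment> \<open>Both claims are instances of this one, with \<open>s = 2\<close> for the
    residues 2 and 18 and \<open>s = 1\<close> for 8 and 12.\<close>
  have linear: "int (stable_digits a b) = (int b - int s) * constant_congruence_speed a
      \<and> constant_congruence_speed a = int ?v"
    if "a \<ge> 2" "even a" "int a mod 5 = 2 \<or> int a mod 5 = 3"
       "s \<ge> 1" "\<not> 4 dvd tetration_diff a (s - 1)" "4 dvd a \<or> s \<ge> 2" "b \<ge> s" for s b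
    using stable_digits_linear[OF that] \<open>b \<ge> s\<close>
      constant_congruence_speed_eqI[OF stable_digits_linear[OF that(1-6)]]
    by (simp add: of_nat_diff)
  \<comment> \<open>The tower of height 0 is 1, so this difference is \<open>a - 1\<close>.\<close>
  have d0: "odd (tetration_diff a 0)" if "a \<ge> 2" "even a"
    using that by (simp add: tetration_diff_def)
  have one: "stable_digits a 1 = 0 \<and> (\<forall>b\<ge>2. int (stable_digits a b)
        = (int b - 2) * constant_congruence_speed a \<and> constant_congruence_speed a = int ?v)"
    if res: "[a = 2] (mod 20) \<or> [a = 18] (mod 20)"
  proof -
    obtain r where r: "a mod 20 = r" "r = 2 \<or> r = 18"
      using res by (auto simp: cong_def)
    then have "a \<noteq> 0" "a \<noteq> 1"
      by auto
    then have *: "a \<ge> 2" "even a" "int a mod 5 = 2 \<or> int a mod 5 = 3" "\<not> 4 dvd a"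
      using residues_of_mod_20[OF r(1)] r(2) by auto
    \<comment> \<open>As 4 divides \<open>a ^ a\<close> but not \<open>a\<close>, it does not divide
      \<open>a ^ a - a\<close>, which forces \<open>s = 2\<close>.\<close>
    have "4 dvd a ^ a"
      using power_2_dvd_tetration[of a 2 1] * by simp
    moreover have "a \<le> a ^ a"
      using tetration_less_Suc[of a 1] * by simp
    ultimately have d1: "\<not> 4 dvd tetration_diff a 1"
      using *(4) by (auto simp: tetration_diff_def dvd_diff_nat dest: dvd_diffD1)
    \<comment> \<open>Height 1 lies below \<open>s = 2\<close> and is settled separately, from the
      odd difference at height 0.\<close>
    have "multiplicity 5 (int (tetration_diff a 1)) = 0"
      using multiplicity_5_tetration_diff_Suc[OF *(1,3), of 0] d0[OF *(1,2)] by auto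
    then have "stable_digits a 1 = 0"
      using stable_digits_eq_multiplicity_5[OF *(1), of 1] by simp
    then show ?thesis
      using linear[OF *(1-3), of 2] d1 by simp
  qed
  have two: "int (stable_digits a b) = (int b - 1) * constant_congruence_speed a
      \<and> constant_congruence_speed a = int ?v"
    if res: "[a = 8] (mod 20) \<or> [a = 12] (mod 20)" and "b \<ge> 1" for b
  proof -
    obtain r where r: "a mod 20 = r" "r = 8 \<or> r = 12"
      using res by (auto simp: cong_def)
    then have "a \<noteq> 0" "a \<noteq> 1"
      by auto
    then have *: "a \<ge> 2" "even a" "int a mod 5 = 2 \<or> int a mod 5 = 3" "4 dvd a"
      using residues_of_mod_20[OF r(1)] r(2) by auto
    then have "\<not> 4 dvd tetration_diff a 0"
      using d0 by auto
    then show ?thesis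
      using linear[OF *(1-3), of 1 b] * \<open>b \<ge> 1\<close> by simp
  qed
  show ?thesis
    using one two by auto
qed

end
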